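(* Let $\mathcal L$ be the fragment of $\mathbf{ACT}_\omega$ without the unit $\mathbf 1$ (but with $\bot$ and $\top$) and with positive iteration $^+$ instead of Kleene iteration. Then $\mathcal L$ is strongly complete with respect to SCL-models with the standard interpretation of $\bot$: for every set $\mathcal H$ of sequents and every sequent $\Pi\to C$ of $\mathcal L$, if $\Pi\to C$ is true in every such model in which all sequents of $\mathcal H$ are true, then $\mathcal H\vdash_{\mathcal L}\Pi\to C$.
   Context: Formulae of $\mathcal L$: built from countably many variables and constants $\top,\bot$ with $\backslash,/,\cdot,\wedge,\vee$ and unary $^+$. Sequents $A_1,\dots,A_n\to B$ with $n\ge0$ (empty antecedents allowed). Rules: $A\to A$; $\Gamma,\bot,\Delta\to C$; $\Pi\to\top$; from $\Gamma,A,B,\Delta\to C$ infer $\Gamma,A\cdot B,\Delta\to C$; from $\Gamma\to A$, $\Delta\to B$ infer $\Gamma,\Delta\to A\cdot B$; from $\Pi\to A$ and $\Gamma,B,\Delta\to C$ infer $\Gamma,\Pi,A\backslash B,\Delta\to C$ and $\Gamma,B/A,\Pi,\Delta\to C$; from $A,\Pi\to B$ infer $\Pi\to A\backslash B$; from $\Pi,A\to B$ infer $\Pi\to B/A$ ($\Pi$ may be empty); from $\Gamma,A,\Delta\to C$ (or $\Gamma,B,\Delta\to C$) infer $\Gamma,A\wedge B,\Delta\to C$; from $\Pi\to A$, $\Pi\to B$ infer $\Pi\to A\wedge B$; from $\Gamma,A,\Delta\to C$ and $\Gamma,B,\Delta\to C$ infer $\Gamma,A\vee B,\Delta\to C$;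 from $\Pi\to A$ (or $\Pi\to B$) infer $\Pi\to A\vee B$; Cut: from $\Pi\to A$ and $\Gamma,A,\Delta\to C$ infer $\Gamma,\Pi,\Delta\to C$; from $\Gamma,A^n,\Delta\to C$ for all $n\ge1$ infer $\Gamma,A^+,\Delta\to C$; for $n\ge1$ from $\Pi_1\to A,\dots,\Pi_n\to A$ infer $\Pi_1,\dots,\Pi_n\to A^+$. Derivations may be infinite but well-founded; $\mathcal H\vdash$ means derivability with $\mathcal H$ as extra axioms. SCL-models with standard $\bot$: alphabet $\Sigma$, $L\subseteq\Sigma^*$; $M^{\rhd}=\{(x,y)\in\Sigma^*\times\Sigma^*\mid\forall w\in M\;xwy\in L\}$, $C^{\lhd}=\{v\in\Sigma^*\mid\forall (x,y)\in C\;xvy\in L\}$; $\mathcal B(L)=\{M\subseteq\Sigma^*\mid M=M^{\rhd\lhd}\}$; an interpretation $\alpha$ of variables in $\mathcal B(L)$ extended by $\alpha(A\cdot B)=(\alpha(A)\alpha(B))^{\rhd\lhd}$, $\alpha(A\backslash B)=\{u\mid\forall v\in\alpha(A)\;vu\in\alpha(B)\}$, $\alpha(B/A)=\{u\mid\forall v\in\alpha(A)\;uv\in\alpha(B)\}$, $\alpha(A\wedge B)=\alpha(A)\cap\alpha(B)$, $\alpha(A\vee B)=(\alpha(A)\cup\alpha(B))^{\rhd\lhd}$, $\alpha(A^+)=(\bigcup_{n\ge1}\alpha(A)^n)^{\rhd\lhd}$, $\alpha(\top)=\Sigma^*$, $\alpha(\bot)=\varnothing^{\rhd\lhd}$. $A_1,\dots,A_n\to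 B$ ($n\ge1$) is true if $(\alpha(A_1)\cdots\alpha(A_n))^{\rhd\lhd}\subseteq\alpha(B)$; $\to B$ is true if $\varepsilon\in\alpha(B)$. *)

theory Defs
  imports Main
begin

section \<open>The calculus\<close>

text \<open>\<open>LDiv A B\<close> is the left division, with the denominator \<open>A\<close> on the left; \<open>RDiv B A\<close> is the
  right division \<open>B / A\<close>.\<close>

datatype fm =
    Var nat
  | Top
  | Bot
  | LDiv fm fm
  | RDiv fm fm
  | Prod fm fm
  | Meet fm fm
  | Join fm fm
  | Plus fm

datatype sequent = Seq "fm list" fm  (infix "\<Rrightarrow>" 50)

text \<open>Being inductive, the predicate captures exactly the well-founded, possibly infinite
  (because of \<open>PlusL\<close>) derivations. Hypotheses are not closed under substitution.\<close>

inductive derivable :: "sequent set \<Rightarrow> sequent \<Rightarrow> bool"  (infix "\<turnstile>" 45)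
  for H :: "sequent set" where
  Hyp: "s \<in> H \<Longrightarrow> H \<turnstile> s"
| Ax: "H \<turnstile> [A] \<Rrightarrow> A"
| BotL: "H \<turnstile> \<Gamma> @ [Bot] @ \<Delta> \<Rrightarrow> C"
| TopR: "H \<turnstile> \<Pi> \<Rrightarrow> Top"
| ProdL: "H \<turnstile> \<Gamma> @ [A, B] @ \<Delta> \<Rrightarrow> C \<Longrightarrow> H \<turnstile> \<Gamma> @ [Prod A B] @ \<Delta> \<Rrightarrow> C"
| ProdR: "H \<turnstile> \<Gamma> \<Rrightarrow> A \<Longrightarrow> H \<turnstile> \<Delta> \<Rrightarrow> B \<Longrightarrow> H \<turnstile> \<Gamma> @ \<Delta> \<Rrightarrow> Prod A B"
| LDivL: "H \<turnstile> \<Pi> \<Rrightarrow> A \<Longrightarrow> H \<turnstile> \<Gamma> @ [B] @ \<Delta> \<Rrightarrow> C \<Longrightarrow> H \<turnstile> \<Gamma> @ \<Pi> @ [LDiv A B] @ \<Delta> \<Rrightarrow> C"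
| LDivR: "H \<turnstile> [A] @ \<Pi> \<Rrightarrow> B \<Longrightarrow> H \<turnstile> \<Pi> \<Rrightarrow> LDiv A B"
| RDivL: "H \<turnstile> \<Pi> \<Rrightarrow> A \<Longrightarrow> H \<turnstile> \<Gamma> @ [B] @ \<Delta> \<Rrightarrow> C \<Longrightarrow> H \<turnstile> \<Gamma> @ [RDiv B A] @ \<Pi> @ \<Delta> \<Rrightarrow> C"
| RDivR: "H \<turnstile> \<Pi> @ [A] \<Rrightarrow> B \<Longrightarrow> H \<turnstile> \<Pi> \<Rrightarrow> RDiv B A"
| MeetL1: "H \<turnstile> \<Gamma> @ [A] @ \<Delta> \<Rrightarrow> C \<Longrightarrow> H \<turnstile> \<Gamma> @ [Meet A B] @ \<Delta> \<Rrightarrow> C"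
| MeetL2: "H \<turnstile> \<Gamma> @ [B] @ \<Delta> \<Rrightarrow> C \<Longrightarrow> H \<turnstile> \<Gamma> @ [Meet A B] @ \<Delta> \<Rrightarrow> C"
| MeetR: "H \<turnstile> \<Pi> \<Rrightarrow> A \<Longrightarrow> H \<turnstile> \<Pi> \<Rrightarrow> B \<Longrightarrow> H \<turnstile> \<Pi> \<Rrightarrow> Meet A B"
| JoinL: "H \<turnstile> \<Gamma> @ [A] @ \<Delta> \<Rrightarrow> C \<Longrightarrow> H \<turnstile> \<Gamma> @ [B] @ \<Delta> \<Rrightarrow> C \<Longrightarrow> H \<turnstile> \<Gamma> @ [Join A B] @ \<Delta> \<Rrightarrow> C"
| JoinR1: "H \<turnstile> \<Pi> \<Rrightarrow> A \<Longrightarrow> H \<turnstile> \<Pi> \<Rrightarrow> Join A B"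
| JoinR2: "H \<turnstile> \<Pi> \<Rrightarrow> B \<Longrightarrow> H \<turnstile> \<Pi> \<Rrightarrow> Join A B"
| Cut: "H \<turnstile> \<Pi> \<Rrightarrow> A \<Longrightarrow> H \<turnstile> \<Gamma> @ [A] @ \<Delta> \<Rrightarrow> C \<Longrightarrow> H \<turnstile> \<Gamma> @ \<Pi> @ \<Delta> \<Rrightarrow> C"
| PlusL: "(\<And>n. n \<ge> 1 \<Longrightarrow> H \<turnstile> \<Gamma> @ replicate n A @ \<Delta> \<Rrightarrow> C) \<Longrightarrow> H \<turnstile> \<Gamma> @ [Plus A] @ \<Delta> \<Rrightarrow> C"
| PlusR: "\<Pi>s \<noteq> [] \<Longrightarrow> (\<And>\<Pi>. \<Pi> \<in> set \<Pi>s \<Longrightarrow> H \<turnstile> \<Pi> \<Rrightarrow> A) \<Longrightarrow> H \<turnstile> concat \<Pi>s \<Rrightarrow> Plus A"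


section \<open>Syntactic concept lattices\<close>

text \<open>An alphabet is a set \<open>S\<close> of letters of type \<open>'a\<close>, possibly infinite; words over it are the
  elements of \<open>lists S\<close>. As HOL cannot quantify over \<open>'a\<close> inside a premise, "all models" is rendered by
  taking \<open>S\<close> to be an arbitrary set of naturals: every countable alphabet, up to renaming letters.\<close>

definition conc :: "'a list set \<Rightarrow> 'a list set \<Rightarrow> 'a list set" where
  "conc M N = {u @ v | u v. u \<in> M \<and> v \<in> N}"

definition conc_list :: "'a list set list \<Rightarrow> 'a list set" where
  "conc_list Ms = foldr conc Ms {[]}"

definition rpolar :: "'a set \<Rightarrow> 'a list set \<Rightarrow> 'a list set \<Rightarrow> ('a list \<times> 'a list) set" where
  "rpolar S L M = {(x, y). x \<in> lists S \<and> y \<in> lists S \<and> (\<forall>w\<in>M. x @ w @ y \<in> L)}"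

definition lpolar :: "'a set \<Rightarrow> 'a list set \<Rightarrow> ('a list \<times> 'a list) set \<Rightarrow> 'a list set" where
  "lpolar S L C = {v \<in> lists S. \<forall>(x, y)\<in>C. x @ v @ y \<in> L}"

definition concept_closure :: "'a set \<Rightarrow> 'a list set \<Rightarrow> 'a list set \<Rightarrow> 'a list set" where
  "concept_closure S L M = lpolar S L (rpolar S L M)"

definition concepts :: "'a set \<Rightarrow> 'a list set \<Rightarrow> 'a list set set" where
  "concepts S L = {M. M \<subseteq> lists S \<and> M = concept_closure S L M}"

primrec interp ::
  "'a set \<Rightarrow> 'a list set \<Rightarrow> (nat \<Rightarrow> 'a list set) \<Rightarrow> fm \<Rightarrow> 'a list set" where
  "interp S L \<alpha> (Var p) = \<alpha> p"
| "interp S L \<alpha> Top = lists S"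
| "interp S L \<alpha> Bot = concept_closure S L {}"
| "interp S L \<alpha> (LDiv A B) = {u \<in> lists S. \<forall>v\<in>interp S L \<alpha> A. v @ u \<in> interp S L \<alpha> B}"
| "interp S L \<alpha> (RDiv B A) = {u \<in> lists S. \<forall>v\<in>interp S L \<alpha> A. u @ v \<in> interp S L \<alpha> B}"
| "interp S L \<alpha> (Prod A B) = concept_closure S L (conc (interp S L \<alpha> A) (interp S L \<alpha> B))"
| "interp S L \<alpha> (Meet A B) = interp S L \<alpha> A \<inter> interp S L \<alpha> B"
| "interp S L \<alpha> (Join A B) = concept_closure S L (interp S L \<alpha> A \<union> interp S L \<alpha> B)"
| "interp S L \<alpha> (Plus A) =
    concept_closure S L (\<Union>n\<in>{1..}. conc_list (replicate n (interp S L \<alpha> A)))"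

definition scl_model :: "'a set \<Rightarrow> 'a list set \<Rightarrow> (nat \<Rightarrow> 'a list set) \<Rightarrow> bool" where
  "scl_model S L \<alpha> \<longleftrightarrow> L \<subseteq> lists S \<and> (\<forall>p. \<alpha> p \<in> concepts S L)"

fun true_in ::
  "'a set \<Rightarrow> 'a list set \<Rightarrow> (nat \<Rightarrow> 'a list set) \<Rightarrow> sequent \<Rightarrow> bool" where
  "true_in S L \<alpha> ([] \<Rrightarrow> B) \<longleftrightarrow> [] \<in> interp S L \<alpha> B"
| "true_in S L \<alpha> (A # As \<Rrightarrow> B) \<longleftrightarrow>
    concept_closure S L (conc_list (map (interp S L \<alpha>) (A # As))) \<subseteq> interp S L \<alpha> B"

end

theory Submission
  imports Defs "HOL-Library.Countable"
begin

text \<open>The canonical model has a letter \<open>\<lceil>A\<rceil>\<close> and a marker \<open>\<lfloor>A\<rfloor>\<close> for every formula \<open>A\<close>. A word is read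
  as a list of formulas by taking \<open>\<lceil>A\<rceil>\<close> to \<open>A\<close> and every marker to \<open>Top\<close>, so that the set
  of words deriving \<open>Top\<close> contains every word. The language consists of the words deriving
  \<open>Bot\<close> and of the words \<open>w\<lfloor>A\<rfloor>\<close> with \<open>w\<close> deriving \<open>A\<close>. Since the empty sequence derives \<open>Top\<close>, the
  first kind does not interfere with the second, and the context \<open>(\<epsilon>, \<lfloor>A\<rfloor>)\<close> cuts out exactly
  the words deriving \<open>A\<close>. As only the last letter acts as a marker, a context acts on
  all nonempty sequences of letters \<open>\<lceil>A\<rceil>\<close> as a single pair of a sequent context and a succedent; this
  uniformity is what the rules for join and iteration require.\<close>

section \<open>Coding of the canonical alphabet and its language\<close>

instance fm :: countable
  by countable_datatype

definition letter :: "fm \<Rightarrow> nat" where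
  "letter A = to_nat (Inl A :: fm + fm)"

definition marker :: "fm \<Rightarrow> nat" where
  "marker A = to_nat (Inr A :: fm + fm)"

text \<open>As \<open>from_nat\<close> is total, a natural outside the range of
  \<open>to_nat\<close> also gets a reading, an unspecified formula. The alphabet can thus be all of
  \<open>UNIV\<close>; such a natural is no marker.\<close>

definition reading :: "nat \<Rightarrow> fm" where
  "reading n = (case (from_nat n :: fm + fm) of Inl A \<Rightarrow> A | Inr _ \<Rightarrow> Top)"

lemma reading_letter [simp]: "reading (letter A) = A"
  by (simp add: reading_def letter_def)

lemma reading_comp_letter [simp]: "reading \<circ> letter = id"
  by (simp add: fun_eq_iff)

lemma reading_marker [simp]: "reading (marker A) = Top"
  by (simp add: reading_def marker_def)

lemma marker_eq_iff [simp]: "marker A = marker B \<longleftrightarrow> A = B"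
  by (simp add: marker_def)

lemma letter_neq_marker [simp]: "letter A \<noteq> marker B"
  by (simp add: letter_def marker_def)

definition deriving :: "sequent set \<Rightarrow> fm \<Rightarrow> nat list set" where
  "deriving H A = {w. H \<turnstile> map reading w \<Rrightarrow> A}"

definition canonical_language :: "sequent set \<Rightarrow> nat list set" where
  "canonical_language H =
    deriving H Bot \<union> {w @ [marker A] | w A. w \<in> deriving H A}"

lemma derivable_of_Bot: "H \<turnstile> \<Pi> \<Rrightarrow> Bot \<Longrightarrow> H \<turnstile> \<Gamma> @ \<Pi> @ \<Delta> \<Rrightarrow> C"
  by (rule Cut[OF _ BotL])

lemma derivable_drop_Top:
  assumes "H \<turnstile> \<Gamma> @ [Top] \<Rrightarrow> C"
  shows "H \<turnstile> \<Gamma> \<Rrightarrow> C"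
  using Cut[OF TopR[of H "[]"], of \<Gamma> "[]" C] assms by simp

text \<open>If the word lies in the language by deriving \<open>Bot\<close>, the final
  \<open>Top\<close> that the marker contributes can be cut away, so \<open>w\<close> derives
  \<open>Bot\<close> and hence \<open>A\<close>. Otherwise injectivity of \<open>marker\<close>
  applies.\<close>

lemma snoc_marker_in_canonical_language:
  "w @ [marker A] \<in> canonical_language H \<longleftrightarrow> w \<in> deriving H A"
proof -
  have "w \<in> deriving H A" if "w @ [marker A] \<in> deriving H Bot"
    using derivable_of_Bot[OF derivable_drop_Top, of H "map reading w" "[]" "[]" A] that
    by (simp add: deriving_def)
  then show ?thesis
    by (auto simp: canonical_language_def)
qed

section \<open>Concept closure and contexts\<close>

lemma concept_closureI:
  assumes "w \<in> lists S"
    and "\<And>x y. \<lbrakk>x \<in> lists S; y \<in> lists S; \<And>v. v \<in> M \<Longrightarrow> x @ v @ y \<in> L\<rbrakk> \<Longrightarrow> x @ w @ y \<in> L"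
  shows "w \<in> concept_closure S L M"
  using assms by (auto simp: concept_closure_def lpolar_def rpolar_def)

lemma concept_closure_extensive: "M \<subseteq> lists S \<Longrightarrow> M \<subseteq> concept_closure S L M"
  by (auto simp: concept_closure_def lpolar_def rpolar_def)

lemma concept_closure_subset_deriving:
  assumes "M \<subseteq> deriving H A"
  shows "concept_closure UNIV (canonical_language H) M \<subseteq> deriving H A"
proof
  fix w
  assume "w \<in> concept_closure UNIV (canonical_language H) M"
  moreover have "([], [marker A]) \<in> rpolar UNIV (canonical_language H) M"
    using assms by (auto simp: rpolar_def snoc_marker_in_canonical_language)
  ultimately have "w @ [marker A] \<in> canonical_language H"
    by (fastforce simp: concept_closure_def lpolar_def)
  then show "w \<in> deriving H A"
    by (simp add: snoc_marker_in_canonical_language)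
qed

lemma deriving_in_concepts: "deriving H A \<in> concepts UNIV (canonical_language H)"
  using concept_closure_subset_deriving[of "deriving H A" H A]
    concept_closure_extensive[of "deriving H A" UNIV]
  by (auto simp: concepts_def)

text \<open>If \<open>y\<close> ends in a marker, that marker supplies the succedent and the rest of
  \<open>y\<close> is read as \<Delta>; otherwise the succedent is \<open>Bot\<close>. The second
  property is confined to nonempty words of letters because, when \<open>y\<close> is empty, a
  marker ending \<open>x\<close> or the inserted word could act as the marker of the whole
  word.\<close>

lemma context_as_sequent:
  obtains \<Delta> C where
    "\<And>w. H \<turnstile> map reading x @ map reading w @ \<Delta> \<Rrightarrow> C \<Longrightarrow> x @ w @ y \<in> canonical_language H"
    "\<And>\<Gamma>. \<Gamma> \<noteq> [] \<Longrightarrow> x @ map letter \<Gamma> @ y \<in> canonical_language H \<Longrightarrow>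
      H \<turnstile> map reading x @ \<Gamma> @ \<Delta> \<Rrightarrow> C"
proof (cases "\<exists>y' C. y = y' @ [marker C]")
  case True
  then obtain y' C where y: "y = y' @ [marker C]"
    by blast
  have "x @ w @ y \<in> canonical_language H \<longleftrightarrow>
      H \<turnstile> map reading x @ map reading w @ map reading y' \<Rrightarrow> C" for w
    using snoc_marker_in_canonical_language[of "x @ w @ y'" C H]
    by (simp add: y deriving_def)
  then show thesis
    using that[of "map reading y'" C] by simp
next
  case False
  have "H \<turnstile> map reading x @ \<Gamma> @ map reading y \<Rrightarrow> Bot"
    if "\<Gamma> \<noteq> []" "x @ map letter \<Gamma> @ y \<in> canonical_language H" for \<Gamma>
  proof -
    have "x @ map letter \<Gamma> @ y \<noteq> w @ [marker C]" for w C
    proof (cases y rule: rev_cases)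
      case Nil
      with that(1) show ?thesis
        by (cases \<Gamma> rule: rev_cases) auto
    next
      case (snoc y' n)
      with False show ?thesis
        by (auto simp flip: append_assoc)
    qed
    with that(2) show ?thesis
      by (auto simp: canonical_language_def deriving_def)
  qed
  moreover have "x @ w @ y \<in> canonical_language H"
    if "H \<turnstile> map reading x @ map reading w @ map reading y \<Rrightarrow> Bot" for w
    using that by (simp add: canonical_language_def deriving_def)
  ultimately show thesis
    by (rule that[rotated])
qed

text \<open>The premise states that \<open>A\<close> is subject to a left rule whose premises have the sequences
  in \<open>G\<close> in place of \<open>A\<close>.\<close>

lemma deriving_subset_concept_closure:
  assumes left: "\<And>\<Gamma> \<Delta> C. (\<And>\<Pi>. \<Pi> \<in> G \<Longrightarrow> H \<turnstile> \<Gamma> @ \<Pi> @ \<Delta> \<Rrightarrow> C) \<Longrightarrow> H \<turnstile> \<Gamma> @ [A] @ \<Delta> \<Rrightarrow> C"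
    and "[] \<notin> G" and "map letter ` G \<subseteq> M"
  shows "deriving H A \<subseteq> concept_closure UNIV (canonical_language H) M"
proof
  fix w
  assume w: "w \<in> deriving H A"
  show "w \<in> concept_closure UNIV (canonical_language H) M"
  proof (rule concept_closureI)
    fix x y
    assume M: "\<And>v. v \<in> M \<Longrightarrow> x @ v @ y \<in> canonical_language H"
    obtain \<Delta> C where
      into: "\<And>w. H \<turnstile> map reading x @ map reading w @ \<Delta> \<Rrightarrow> C \<Longrightarrow> x @ w @ y \<in> canonical_language H"
      and out: "\<And>\<Gamma>. \<Gamma> \<noteq> [] \<Longrightarrow> x @ map letter \<Gamma> @ y \<in> canonical_language H \<Longrightarrow>
        H \<turnstile> map reading x @ \<Gamma> @ \<Delta> \<Rrightarrow> C"
      using context_as_sequent[of H x y] by blast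
    \<comment> \<open>\<Delta> and \<open>C\<close> were fixed before \<Pi>, so these are the
      premises of one instance of the left rule; a cut on \<open>A\<close> then puts the reading of
      \<open>w\<close> in its place.\<close>
    have "H \<turnstile> map reading x @ \<Pi> @ \<Delta> \<Rrightarrow> C" if "\<Pi> \<in> G" for \<Pi>
      using that assms(2,3) by (intro out M) auto
    then have "H \<turnstile> map reading x @ [A] @ \<Delta> \<Rrightarrow> C"
      by (rule left)
    with Cut[of H "map reading w" A] w
    have "H \<turnstile> map reading x @ map reading w @ \<Delta> \<Rrightarrow> C"
      by (simp add: deriving_def)
    then show "x @ w @ y \<in> canonical_language H"
      by (rule into)
  qed simp
qed

section \<open>Products of concepts and simultaneous cuts\<close>

lemma conc_list_simps [simp]:
  "conc_list [] = {[]}"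
  "conc_list (M # Ms) = conc M (conc_list Ms)"
  by (simp_all add: conc_list_def)

text \<open>The division into blocks is kept: the blocks serve as premises of \<open>PlusR\<close>
  and of repeated cuts.\<close>

lemma mem_conc_list_deriving_split:
  assumes "w \<in> conc_list (map (deriving H) As)"
  obtains \<Pi>s where "map reading w = concat \<Pi>s"
    "list_all2 (\<lambda>\<Pi> A. H \<turnstile> \<Pi> \<Rrightarrow> A) \<Pi>s As"
  using assms
proof (induction As arbitrary: w thesis)
  case Nil
  then show ?case by simp
next
  case (Cons A As)
  then obtain u v where w: "w = u @ v" and u: "u \<in> deriving H A"
    and v: "v \<in> conc_list (map (deriving H) As)"
    by (auto simp: conc_def)
  obtain \<Pi>s where "map reading v = concat \<Pi>s" "list_all2 (\<lambda>\<Pi> A. H \<turnstile> \<Pi> \<Rrightarrow> A) \<Pi>s As"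
    using Cons.IH[OF _ v] by blast
  with w u Cons.prems(1)[of "map reading u # \<Pi>s"] show ?case
    by (simp add: deriving_def)
qed

text \<open>The cuts run from left to right; \<Gamma> is general so that it can absorb the blocks
  already substituted.\<close>

lemma derivable_cut_list:
  assumes "list_all2 (\<lambda>\<Pi> A. H \<turnstile> \<Pi> \<Rrightarrow> A) \<Pi>s As" "H \<turnstile> \<Gamma> @ As \<Rrightarrow> C"
  shows "H \<turnstile> \<Gamma> @ concat \<Pi>s \<Rrightarrow> C"
  using assms
proof (induction arbitrary: \<Gamma>)
  case Nil
  then show ?case by simp
next
  case (Cons \<Pi> A \<Pi>s As)
  have "H \<turnstile> \<Gamma> @ \<Pi> @ As \<Rrightarrow> C"
    using Cut[OF Cons.hyps(1), of \<Gamma> As C] Cons.prems by simp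
  then show ?case
    using Cons.IH[of "\<Gamma> @ \<Pi>"] by simp
qed

lemma map_letter_in_conc_list:
  "map letter As \<in> conc_list (map (deriving H) As)"
proof (induction As)
  case (Cons A As)
  moreover have "[letter A] \<in> deriving H A"
    by (simp add: deriving_def Ax)
  ultimately have "[letter A] @ map letter As \<in>
      conc (deriving H A) (conc_list (map (deriving H) As))"
    unfolding conc_def by blast
  then show ?case
    by simp
qed simp

section \<open>Truth and derivability in the canonical model\<close>

abbreviation canonical_interp :: "sequent set \<Rightarrow> fm \<Rightarrow> nat list set" where
  "canonical_interp H \<equiv> interp UNIV (canonical_language H) (\<lambda>p. deriving H (Var p))"

text \<open>For \<open>Prod\<close>, \<open>Join\<close> and \<open>Plus\<close> the left rule puts
  the derivable words into the closure, and the right rule with closedness of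
  \<open>deriving\<close> gives the converse. For the divisions and \<open>Meet\<close>, the right
  rule gives one inclusion and a cut against the left rule the other.\<close>

lemma canonical_interp_eq: "canonical_interp H A = deriving H A"
proof (induction A)
  case (Var p)
  show ?case by simp
next
  case Top
  show ?case by (simp add: deriving_def TopR)
next
  case Bot
  have "deriving H Bot \<subseteq> concept_closure UNIV (canonical_language H) {}"
    \<comment> \<open>\<open>BotL\<close> is a left rule without premises, hence the empty
      \<open>G\<close>.\<close>
    by (rule deriving_subset_concept_closure[where G = "{}"]) (use BotL in auto)
  then show ?case
    using concept_closure_subset_deriving[of "{}" H Bot] by simp
next
  case (LDiv A B)
  have "v @ u \<in> deriving H B" if "u \<in> deriving H (LDiv A B)" "v \<in> deriving H A" for u v
  proof -
    have "H \<turnstile> [] @ map reading v @ [LDiv A B] @ [] \<Rrightarrow> B"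
      using that(2) by (intro LDivL) (simp_all add: deriving_def Ax)
    then show ?thesis
      using that(1) Cut[of H "map reading u" "LDiv A B" "map reading v" "[]" B]
      by (simp add: deriving_def)
  qed
  moreover have "u \<in> deriving H (LDiv A B)"
    if "\<forall>v\<in>deriving H A. v @ u \<in> deriving H B" for u
    \<comment> \<open>The single test word \<open>[letter A]\<close> already yields the premise of
      \<open>LDivR\<close>.\<close>
    using that[rule_format, of "[letter A]"] by (auto simp: deriving_def Ax intro: LDivR)
  ultimately show ?case
    by (auto simp: LDiv)
next
  case (RDiv B A)
  have "u @ v \<in> deriving H B" if "u \<in> deriving H (RDiv B A)" "v \<in> deriving H A" for u v
  proof -
    have "H \<turnstile> [] @ [RDiv B A] @ map reading v @ [] \<Rrightarrow> B"
      using that(2) by (intro RDivL) (simp_all add: deriving_def Ax)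
    then show ?thesis
      using that(1) Cut[of H "map reading u" "RDiv B A" "[]" "map reading v" B]
      by (simp add: deriving_def)
  qed
  moreover have "u \<in> deriving H (RDiv B A)"
    if "\<forall>v\<in>deriving H A. u @ v \<in> deriving H B" for u
    using that[rule_format, of "[letter A]"] by (auto simp: deriving_def Ax intro: RDivR)
  ultimately show ?case
    by (auto simp: RDiv)
next
  case (Prod A B)
  have "[letter A, letter B] \<in> conc (deriving H A) (deriving H B)"
    using map_letter_in_conc_list[of "[A, B]" H] by (simp add: conc_def)
  then have "deriving H (Prod A B) \<subseteq>
      concept_closure UNIV (canonical_language H) (conc (deriving H A) (deriving H B))"
    by (intro deriving_subset_concept_closure[where G = "{[A, B]}"] ProdL) auto
  moreover have "conc (deriving H A) (deriving H B) \<subseteq> deriving H (Prod A B)"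
    by (auto simp: conc_def deriving_def intro: ProdR)
  ultimately show ?case
    using concept_closure_subset_deriving by (simp add: Prod subset_antisym)
next
  case (Meet A B)
  have "H \<turnstile> \<Pi> \<Rrightarrow> A" "H \<turnstile> \<Pi> \<Rrightarrow> B" if "H \<turnstile> \<Pi> \<Rrightarrow> Meet A B" for \<Pi>
    using Cut[OF that, of "[]" "[]"] MeetL1[of H "[]" A "[]" A B] MeetL2[of H "[]" B "[]" B A]
    by (simp_all add: Ax)
  then have "deriving H A \<inter> deriving H B = deriving H (Meet A B)"
    by (auto simp: deriving_def intro: MeetR)
  then show ?case
    by (simp add: Meet)
next
  case (Join A B)
  have "deriving H (Join A B) \<subseteq>
      concept_closure UNIV (canonical_language H) (deriving H A \<union> deriving H B)"
    by (rule deriving_subset_concept_closure[where G = "{[A], [B]}"], rule JoinL, blast, blast)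
      (auto simp: deriving_def Ax)
  moreover have "deriving H A \<union> deriving H B \<subseteq> deriving H (Join A B)"
    by (auto simp: deriving_def intro: JoinR1 JoinR2)
  ultimately show ?case
    using concept_closure_subset_deriving by (simp add: Join subset_antisym)
next
  case (Plus A)
  let ?M = "\<Union>n\<in>{1..}. conc_list (replicate n (deriving H A))"
  have "map letter (replicate n A) \<in> conc_list (replicate n (deriving H A))" for n
    using map_letter_in_conc_list[of "replicate n A" H] by simp
  then have "deriving H (Plus A) \<subseteq> concept_closure UNIV (canonical_language H) ?M"
    \<comment> \<open>All premises of the infinitary rule at once; starting at 1 keeps
      \<open>[]\<close> out of \<open>G\<close>.\<close>
    by (intro deriving_subset_concept_closure[where G = "(\<lambda>n. replicate n A) ` {1..}"] PlusL)
      fastforce+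
  moreover have "?M \<subseteq> deriving H (Plus A)"
  proof
    fix w
    assume "w \<in> ?M"
    then obtain n where "n \<ge> 1" "w \<in> conc_list (map (deriving H) (replicate n A))"
      by auto
    moreover from this(2) obtain \<Pi>s where w: "map reading w = concat \<Pi>s"
      and \<Pi>s: "list_all2 (\<lambda>\<Pi> A. H \<turnstile> \<Pi> \<Rrightarrow> A) \<Pi>s (replicate n A)"
      by (rule mem_conc_list_deriving_split)
    ultimately have "H \<turnstile> concat \<Pi>s \<Rrightarrow> Plus A"
      by (intro PlusR) (auto simp: list_all2_conv_all_nth in_set_conv_nth)
    with w show "w \<in> deriving H (Plus A)"
      by (simp add: deriving_def)
  qed
  ultimately show ?case
    using concept_closure_subset_deriving by (simp add: Plus subset_antisym)
qed

text \<open>From truth to derivability, the word \<open>map letter \<Gamma>\<close> lies in the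
  product and reads back as \<Gamma>; conversely, the blocks of any word in the product are cut into
  the sequent. One model thus refutes every underivable sequent.\<close>

lemma true_in_canonical_iff:
  "true_in UNIV (canonical_language H) (\<lambda>p. deriving H (Var p)) (\<Gamma> \<Rrightarrow> C) \<longleftrightarrow> H \<turnstile> \<Gamma> \<Rrightarrow> C"
proof (cases \<Gamma>)
  case Nil
  have "[] \<in> deriving H C \<longleftrightarrow> H \<turnstile> [] \<Rrightarrow> C"
    by (simp add: deriving_def)
  then show ?thesis
    by (simp add: Nil canonical_interp_eq)
next
  case (Cons A As)
  let ?M = "conc_list (map (deriving H) \<Gamma>)"
  have "concept_closure UNIV (canonical_language H) ?M \<subseteq> deriving H C \<longleftrightarrow> H \<turnstile> \<Gamma> \<Rrightarrow> C"
  proof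
    assume "concept_closure UNIV (canonical_language H) ?M \<subseteq> deriving H C"
    moreover have "map letter \<Gamma> \<in> concept_closure UNIV (canonical_language H) ?M"
      using map_letter_in_conc_list concept_closure_extensive[of ?M UNIV] by auto
    ultimately show "H \<turnstile> \<Gamma> \<Rrightarrow> C"
      by (auto simp: deriving_def)
  next
    assume \<Gamma>: "H \<turnstile> \<Gamma> \<Rrightarrow> C"
    have "?M \<subseteq> deriving H C"
    proof
      fix w
      assume "w \<in> ?M"
      then obtain \<Pi>s where "map reading w = concat \<Pi>s"
        "list_all2 (\<lambda>\<Pi> A. H \<turnstile> \<Pi> \<Rrightarrow> A) \<Pi>s \<Gamma>"
        by (rule mem_conc_list_deriving_split)
      with \<Gamma> derivable_cut_list[of H \<Pi>s \<Gamma> "[]" C] show "w \<in> deriving H C"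
        by (simp add: deriving_def)
    qed
    then show "concept_closure UNIV (canonical_language H) ?M \<subseteq> deriving H C"
      by (rule concept_closure_subset_deriving)
  qed
  then show ?thesis
    by (simp add: Cons canonical_interp_eq cong: map_cong)
qed

theorem theorem6:
  fixes H :: "sequent set" and \<Pi> :: "fm list" and C :: fm
  assumes "\<And>(S :: nat set) L \<alpha>.
    scl_model S L \<alpha> \<Longrightarrow> (\<forall>s\<in>H. true_in S L \<alpha> s) \<Longrightarrow> true_in S L \<alpha> (\<Pi> \<Rrightarrow> C)"
  shows "H \<turnstile> \<Pi> \<Rrightarrow> C"
proof -
  let ?L = "canonical_language H" and ?\<alpha> = "\<lambda>p. deriving H (Var p)"
  have "scl_model UNIV ?L ?\<alpha>"
    by (simp add: scl_model_def deriving_in_concepts)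
  moreover have "true_in UNIV ?L ?\<alpha> s" if "s \<in> H" for s
    using that by (cases s) (simp only: true_in_canonical_iff Hyp)
  ultimately show ?thesis
    using assms true_in_canonical_iff by blast
qed

end
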